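(* Let $I \subseteq \mathbb{R}$ be an open interval and $a \in I$. If $s : I \to \mathbb{R}$ satisfies $\mathbf{PII}_0$ on $I$ and is zero only at $a$ (that is, $s(a) = 0$ and $s(t) \neq 0$ for all $t \in I \setminus \{a\}$), then $s^2$ satisfies $\mathbf{XX}$ on $I$.
   Context: Everything is real: $t$ is a real variable and solutions are real-valued. The homogeneous second Painlevé equation $\mathbf{PII}_0$ is $$s'' = 2 s^3 + t s;$$ a solution on an open interval $I$ is a twice-differentiable function $s : I \to \mathbb{R}$ with $s''(t) = 2s(t)^3 + t s(t)$ for all $t \in I$. Equation $\mathbf{XX}$ is $$S'' = \frac{(S')^2}{2S} + 4 S^2 + 2 t S,$$ where the ratio $(S')^2/(2S)$ is understood as a limit at zeros of $S$. Precisely, a solution to $\mathbf{XX}$ on an open interval $I$ is a twice-differentiable function $S : I \to \mathbb{R}$ such that (i) at every $t \in I$ with $S(t) \neq 0$ one has $S''(t) = \frac{S'(t)^2}{2S(t)} + 4S(t)^2 + 2tS(t)$; and (ii) at every isolated zero $a \in I$ of $S$ the limit $\lim_{t \to a,\, t\neq a} \frac{S'(t)^2}{2S(t)}$ exists as a real number and $S''(a) = \lim_{t \to a} \frac{S'(t)^2}{2S(t)} + 4S(a)^2 + 2aS(a)$. *)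

theory Defs
  imports "HOL-Analysis.Analysis"
begin

text \<open>
  Functions on an open interval \<open>I\<close> are represented by total functions on the reals. All
  conditions are imposed at points of \<open>I\<close> only; since \<open>I\<close> is open, derivatives and limits at
  such points depend only on the values on \<open>I\<close>.
\<close>

definition twice_differentiable_on :: "(real \<Rightarrow> real) \<Rightarrow> real set \<Rightarrow> bool" where
  "twice_differentiable_on f I \<longleftrightarrow>
     (\<forall>t\<in>I. f differentiable (at t) \<and> deriv f differentiable (at t))"

definition PII0_solution_on :: "(real \<Rightarrow> real) \<Rightarrow> real set \<Rightarrow> bool" where
  "PII0_solution_on s I \<longleftrightarrow>
     twice_differentiable_on s I \<and>
     (\<forall>t\<in>I. deriv (deriv s) t = 2 * (s t)^3 + t * s t)"

definition XX_solution_on :: "(real \<Rightarrow> real) \<Rightarrow> real set \<Rightarrow> bool" where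
  "XX_solution_on S I \<longleftrightarrow>
     twice_differentiable_on S I \<and>
     (\<forall>t\<in>I. S t \<noteq> 0 \<longrightarrow>
        deriv (deriv S) t = (deriv S t)^2 / (2 * S t) + 4 * (S t)^2 + 2 * t * S t) \<and>
     (\<forall>a. a isolated_in {t \<in> I. S t = 0} \<longrightarrow>
        (\<exists>L. ((\<lambda>t. (deriv S t)^2 / (2 * S t)) \<longlongrightarrow> L) (at a) \<and>
             deriv (deriv S) a = L + 4 * (S a)^2 + 2 * a * S a))"

end

theory Submission
  imports Defs
begin

text \<open>
  Write \<open>S = s\<^sup>2\<close>. Then \<open>S' = 2 s s'\<close> and \<open>S'' = 2 s'\<^sup>2 + 2 s s''\<close>. Wherever \<open>s\<close> is nonzero, the
  ratio \<open>S'\<^sup>2 / (2 S)\<close> is exactly \<open>2 s'\<^sup>2\<close>, the first term of \<open>S''\<close>, while the equation for \<open>s\<close>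
  turns the second term into \<open>4 S\<^sup>2 + 2 t S\<close>. Since \<open>s'\<close> is differentiable, hence continuous, the
  ratio extends continuously by \<open>2 s'\<^sup>2\<close> across an isolated zero, so the same identity
  gives the limiting form of the equation there.
\<close>

lemma deriv_square:
  fixes s :: "real \<Rightarrow> real"
  assumes "s differentiable (at t)"
  shows "((\<lambda>u. (s u)\<^sup>2) has_field_derivative 2 * s t * deriv s t) (at t)"
    and "deriv (\<lambda>u. (s u)\<^sup>2) t = 2 * s t * deriv s t"
proof -
  have "(s has_field_derivative deriv s t) (at t)"
    using assms by (simp add: DERIV_deriv_iff_real_differentiable)
  then show D: "((\<lambda>u. (s u)\<^sup>2) has_field_derivative 2 * s t * deriv s t) (at t)"
    by (auto intro!: derivative_eq_intros)
  show "deriv (\<lambda>u. (s u)\<^sup>2) t = 2 * s t * deriv s t"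
    by (rule DERIV_imp_deriv[OF D])
qed

lemma square_ratio_at_nonzero:
  fixes s :: "real \<Rightarrow> real"
  assumes "s differentiable (at t)" "s t \<noteq> 0"
  shows "(deriv (\<lambda>u. (s u)\<^sup>2) t)\<^sup>2 / (2 * (s t)\<^sup>2) = 2 * (deriv s t)\<^sup>2"
  unfolding deriv_square(2)[OF assms(1)] using assms(2) by (simp add: power2_eq_square)

text \<open>
  The formula for \<open>S'\<close> may be differentiated once more because it holds throughout the open set
  \<open>I\<close>, not merely at the point \<open>t\<close>.
\<close>

lemma second_deriv_square:
  fixes s :: "real \<Rightarrow> real"
  assumes "open I" "twice_differentiable_on s I" "t \<in> I"
  shows "(deriv (\<lambda>u. (s u)\<^sup>2) has_field_derivative
           2 * (deriv s t)\<^sup>2 + 2 * s t * deriv (deriv s) t) (at t)"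
proof (rule has_field_derivative_transform_within_open)
  have "(s has_field_derivative deriv s t) (at t)"
    and "(deriv s has_field_derivative deriv (deriv s) t) (at t)"
    using assms by (simp_all add: twice_differentiable_on_def DERIV_deriv_iff_real_differentiable)
  then show "((\<lambda>u. 2 * s u * deriv s u) has_field_derivative
      2 * (deriv s t)\<^sup>2 + 2 * s t * deriv (deriv s) t) (at t)"
    by (auto intro!: derivative_eq_intros simp: power2_eq_square)
  show "2 * s u * deriv s u = deriv (\<lambda>u. (s u)\<^sup>2) u" if "u \<in> I" for u
    using assms that by (simp add: twice_differentiable_on_def deriv_square(2))
qed (use assms in auto)

lemma tendsto_square_ratio_at_isolated_zero:
  fixes s :: "real \<Rightarrow> real"
  assumes "open I" "twice_differentiable_on s I" "b isolated_in {t \<in> I. s t = 0}"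
  shows "((\<lambda>t. (deriv (\<lambda>u. (s u)\<^sup>2) t)\<^sup>2 / (2 * (s t)\<^sup>2)) \<longlongrightarrow> 2 * (deriv s b)\<^sup>2) (at b)"
proof (rule Lim_transform_eventually)
  have b: "b \<in> I"
    using assms(3) by (simp add: isolated_in_def)
  then have "isCont (deriv s) b"
    using assms(2) by (simp add: twice_differentiable_on_def differentiable_imp_continuous_within)
  then show "((\<lambda>t. 2 * (deriv s t)\<^sup>2) \<longlongrightarrow> 2 * (deriv s b)\<^sup>2) (at b)"
    by (auto intro!: tendsto_intros simp: isCont_def)
  obtain T where T: "open T" "T \<inter> {t \<in> I. s t = 0} = {b}"
    using assms(3) by (auto simp: isolated_in_def)
  have "eventually (\<lambda>t. t \<in> T \<inter> I - {b}) (at b)"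
    using assms(1) T b by (intro eventually_at_in_open) auto
  then show "eventually (\<lambda>t. 2 * (deriv s t)\<^sup>2 =
      (deriv (\<lambda>u. (s u)\<^sup>2) t)\<^sup>2 / (2 * (s t)\<^sup>2)) (at b)"
  proof eventually_elim
    case (elim t)
    then have "s t \<noteq> 0" and "s differentiable (at t)"
      using T assms(2) by (auto simp: twice_differentiable_on_def)
    then show ?case
      by (simp add: square_ratio_at_nonzero)
  qed
qed

theorem theorem4:
  fixes I :: "real set" and a :: real and s :: "real \<Rightarrow> real"
  assumes "open I" and "is_interval I" and "a \<in> I"
    and "PII0_solution_on s I"
    and "s a = 0" and "\<forall>t\<in>I - {a}. s t \<noteq> 0"
  shows "XX_solution_on (\<lambda>t. (s t)^2) I"
proof -
  have tw: "twice_differentiable_on s I"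
    and ode: "\<And>t. t \<in> I \<Longrightarrow> deriv (deriv s) t = 2 * (s t)^3 + t * s t"
    using assms(4) by (auto simp: PII0_solution_on_def)
  note D2 = second_deriv_square[OF assms(1) tw]
  have second: "deriv (deriv (\<lambda>u. (s u)\<^sup>2)) t
      = 2 * (deriv s t)\<^sup>2 + 4 * ((s t)\<^sup>2)\<^sup>2 + 2 * t * (s t)\<^sup>2" if "t \<in> I" for t
    using DERIV_imp_deriv[OF D2[OF that]] ode[OF that]
    by (simp add: algebra_simps power2_eq_square power3_eq_cube)
  have "twice_differentiable_on (\<lambda>u. (s u)\<^sup>2) I"
    unfolding twice_differentiable_on_def
  proof (intro ballI conjI)
    fix t assume "t \<in> I"
    then have "s differentiable (at t)"
      using tw by (simp add: twice_differentiable_on_def)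
    from deriv_square(1)[OF this] show "(\<lambda>u. (s u)\<^sup>2) differentiable (at t)"
      unfolding real_differentiable_def by blast
    from D2[OF \<open>t \<in> I\<close>] show "deriv (\<lambda>u. (s u)\<^sup>2) differentiable (at t)"
      unfolding real_differentiable_def by blast
  qed
  moreover have "(deriv (\<lambda>u. (s u)\<^sup>2) t)\<^sup>2 / (2 * (s t)\<^sup>2) = 2 * (deriv s t)\<^sup>2"
    if "t \<in> I" "s t \<noteq> 0" for t
    using tw that by (intro square_ratio_at_nonzero) (auto simp: twice_differentiable_on_def)
  moreover have "b \<in> I" if "b isolated_in {t \<in> I. s t = 0}" for b
    using that by (simp add: isolated_in_def)
  ultimately show ?thesis
    unfolding XX_solution_on_def
    using second tendsto_square_ratio_at_isolated_zero[OF assms(1) tw] by auto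
qed

end
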